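(* Let $\Bbbk$ be a field, let $p\in\{-1,1\}$, and let $\mathbb{D}$ be the $\Bbbk$-algebra generated by $y_1,y_2,x_1,x_2$ subject to the relations $$x_2x_1=-x_1x_2,\quad y_2y_1=p\,y_1y_2,\quad y_1x_1=-p\,x_1y_1,\quad y_1x_2=-p^2x_2y_1+x_1y_2,$$ $$y_2x_1=p\,x_1y_2,\quad y_2x_2=x_1y_1+x_2y_2.$$ Let $S\subset\Bbbk\{y_1,y_2,x_1,x_2\}$ be the set consisting of the six polynomials $$x_2x_1+x_1x_2,\quad y_2y_1-p\,y_1y_2,\quad x_1y_1+p\,y_1x_1,\quad x_2y_1+y_1x_2-\tfrac1p\,y_2x_1,$$ $$x_1y_2-\tfrac1p\,y_2x_1,\quad x_2y_2-y_2x_2-p\,y_1x_1.$$ Then, with respect to the degree lexicographic order with $y_1\prec y_2\prec x_1\prec x_2$, the set $S$ is a Gröbner-Shirshov basis of the ideal $\mathrm{Id}(S)$, which is the ideal of defining relations of $\mathbb{D}$, i.e. $\mathbb{D}=\Bbbk\{y_1,y_2,x_1,x_2\}/\mathrm{Id}(S)$.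
   Context: Let $X=\{y_1,y_2,x_1,x_2\}$, let $X^*$ be the free monoid of words in $X$, and let $\Bbbk\{X\}$ be the free associative unital $\Bbbk$-algebra on $X$ (noncommutative polynomials). $\mathrm{Id}(S)$ denotes the two-sided ideal of $\Bbbk\{X\}$ generated by $S$. The degree lexicographic order $\prec$ on $X^*$ compares words first by length and then, for equal length, lexicographically from left to right with $y_1\prec y_2\prec x_1\prec x_2$. For a nonzero $f\in\Bbbk\{X\}$, $\overline{f}$ denotes its leading (i.e. $\prec$-largest) word; $f$ is monic if the coefficient of $\overline{f}$ is $1$. For monic $f,g$: (i) if $w=\overline{f}a=b\overline{g}$ with $a,b\in X^*$ and $|\overline{f}|+|\overline{g}|>|w|$, then $(f,g)_w:=fa-bg$ is the intersection composition; (ii) if $w=\overline{f}=a\overline{g}b$ with $a,b\in X^*$, then $(f,g)_w:=f-agb$ is the inclusion composition. A composition $(f,g)_w$ is trivial modulo $S$ if $(f,g)_w=\sum_i\alpha_i a_is_ib_i$ (finite sum) with $\alpha_i\in\Bbbk$, $a_i,b_i\in X^*$, $s_i\in S$ and $a_i\overline{s_i}b_i\prec w$ for all $i$. A nonempty set $S$ of monic polynomials is a Gröbner-Shirshov basis of $\mathrm{Id}(S)$ if every composition $(f,g)_w$ with $f,g\in S$ is trivial modulo $S$. *)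

theory Defs
  imports "HOL-Library.Poly_Mapping" "HOL-Algebra.QuotRing" "HOL-Algebra.Module"
begin

text \<open>
  Words over \<open>'x\<close> are lists, which form the free monoid. In class \<^class>\<open>monoid_add\<close> its
  operation is written additively, so that the product of \<^theory>\<open>HOL-Library.Poly_Mapping\<close>
  on \<open>'x list \<Rightarrow>\<^sub>0 'k\<close> is the one of the monoid algebra of the free monoid, that is,
  of the free associative unital algebra on \<open>'x\<close>.
\<close>

instantiation list :: (type) monoid_add
begin

definition zero_list :: "'a list" where "zero_list = []"

definition plus_list :: "'a list \<Rightarrow> 'a list \<Rightarrow> 'a list" where "plus_list = (@)"

instance by standard (simp_all add: zero_list_def plus_list_def)

end

type_synonym ('x, 'k) ncpoly = "'x list \<Rightarrow>\<^sub>0 'k"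

definition word :: "'x list \<Rightarrow> ('x, 'k::field) ncpoly" where
  "word w = Poly_Mapping.single w 1"

definition scale :: "'k::field \<Rightarrow> ('x, 'k) ncpoly \<Rightarrow> ('x, 'k) ncpoly" (infixr \<open>*\<^sub>k\<close> 75) where
  "c *\<^sub>k f = Poly_Mapping.single [] c * f"

definition free_algebra :: "('k::field, ('x, 'k) ncpoly) module" where
  "free_algebra =
    \<lparr>carrier = UNIV, monoid.mult = (*), one = 1, ring.zero = 0, add = (+), module.smult = (*\<^sub>k)\<rparr>"

text \<open>Since the ring is unital, its two-sided ideals are closed under scalars.\<close>

abbreviation generated_ideal :: "('x, 'k::field) ncpoly set \<Rightarrow> ('x, 'k) ncpoly set" where
  "generated_ideal S \<equiv> genideal free_algebra S"

text \<open>The quotient ring together with the scalar multiplication \<open>c (I + f) = I + c f\<close>.\<close>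

definition quotient_algebra :: "('k, 'a) module \<Rightarrow> 'a set \<Rightarrow> ('k, 'a set) module" where
  "quotient_algebra A I =
    ring.extend (A Quot I) (module.fields (\<lambda>c C. \<Union>f\<in>C. I +>\<^bsub>A\<^esub> (c \<odot>\<^bsub>A\<^esub> f)))"

text \<open>A pair \<open>(l, r)\<close> stands for the relation \<open>l = r\<close>.\<close>

definition relation_ideal ::
    "(('x, 'k::field) ncpoly \<times> ('x, 'k) ncpoly) set \<Rightarrow> ('x, 'k) ncpoly set" where
  "relation_ideal R = generated_ideal {l - r | l r. (l, r) \<in> R}"

definition presented_algebra ::
    "(('x, 'k::field) ncpoly \<times> ('x, 'k) ncpoly) set \<Rightarrow> ('k, ('x, 'k) ncpoly set) module" where
  "presented_algebra R = quotient_algebra free_algebra (relation_ideal R)"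

definition deglex :: "'x::linorder list \<Rightarrow> 'x list \<Rightarrow> bool" (infix \<open>\<prec>\<close> 50) where
  "u \<prec> v \<longleftrightarrow> (u, v) \<in> lenlex {(a, b). a < b}"

text \<open>Unspecified for the zero polynomial.\<close>

definition leading_word :: "('x::linorder, 'k::field) ncpoly \<Rightarrow> 'x list" where
  "leading_word f =
    (THE w. w \<in> Poly_Mapping.keys f \<and> (\<forall>v\<in>Poly_Mapping.keys f. v \<noteq> w \<longrightarrow> v \<prec> w))"

definition monic :: "('x::linorder, 'k::field) ncpoly \<Rightarrow> bool" where
  "monic f \<longleftrightarrow> f \<noteq> 0 \<and> Poly_Mapping.lookup f (leading_word f) = 1"

text \<open>\<open>composition f g w h\<close> means that \<open>h\<close> is a composition \<open>(f, g)\<^sub>w\<close>.\<close>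

inductive composition ::
    "('x::linorder, 'k::field) ncpoly \<Rightarrow> ('x, 'k) ncpoly \<Rightarrow> 'x list \<Rightarrow> ('x, 'k) ncpoly \<Rightarrow> bool" where
  intersection:
    "\<lbrakk>w = leading_word f @ a; w = b @ leading_word g;
      length (leading_word f) + length (leading_word g) > length w\<rbrakk>
     \<Longrightarrow> composition f g w (f * word a - word b * g)"
| inclusion:
    "\<lbrakk>w = leading_word f; w = a @ leading_word g @ b\<rbrakk>
     \<Longrightarrow> composition f g w (f - word a * g * word b)"

definition trivial_modulo ::
    "('x::linorder, 'k::field) ncpoly set \<Rightarrow> 'x list \<Rightarrow> ('x, 'k) ncpoly \<Rightarrow> bool" where
  "trivial_modulo S w h \<longleftrightarrow>
    (\<exists>(n::nat) \<alpha> a s b.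
      h = (\<Sum>i<n. \<alpha> i *\<^sub>k (word (a i) * s i * word (b i))) \<and>
      (\<forall>i<n. s i \<in> S \<and> a i @ leading_word (s i) @ b i \<prec> w))"

text \<open>\<open>S\<close> is a Groebner-Shirshov basis of the ideal \<open>generated_ideal S\<close>.\<close>

definition groebner_shirshov_basis :: "('x::linorder, 'k::field) ncpoly set \<Rightarrow> bool" where
  "groebner_shirshov_basis S \<longleftrightarrow>
    S \<noteq> {} \<and> (\<forall>f\<in>S. monic f) \<and>
    (\<forall>f\<in>S. \<forall>g\<in>S. \<forall>w h. composition f g w h \<longrightarrow> trivial_modulo S w h)"

datatype gen = Y1 | Y2 | X1 | X2

primrec rank :: "gen \<Rightarrow> nat" where
  "rank Y1 = 0"
| "rank Y2 = 1"
| "rank X1 = 2"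
| "rank X2 = 3"

instantiation gen :: linorder
begin

definition less_eq_gen :: "gen \<Rightarrow> gen \<Rightarrow> bool" where "a \<le> b \<longleftrightarrow> rank a \<le> rank b"

definition less_gen :: "gen \<Rightarrow> gen \<Rightarrow> bool" where "a < b \<longleftrightarrow> rank a < rank b"

instance
proof
  fix a b :: gen
  show "a \<le> b \<Longrightarrow> b \<le> a \<Longrightarrow> a = b"
    by (cases a; cases b) (simp_all add: less_eq_gen_def)
qed (auto simp: less_eq_gen_def less_gen_def)

end

abbreviation y1 :: "(gen, 'k::field) ncpoly" where "y1 \<equiv> word [Y1]"
abbreviation y2 :: "(gen, 'k::field) ncpoly" where "y2 \<equiv> word [Y2]"
abbreviation x1 :: "(gen, 'k::field) ncpoly" where "x1 \<equiv> word [X1]"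
abbreviation x2 :: "(gen, 'k::field) ncpoly" where "x2 \<equiv> word [X2]"

definition D_relations :: "'k::field \<Rightarrow> ((gen, 'k) ncpoly \<times> (gen, 'k) ncpoly) set" where
  "D_relations p =
    {(x2 * x1, - (x1 * x2)),
     (y2 * y1, p *\<^sub>k (y1 * y2)),
     (y1 * x1, (- p) *\<^sub>k (x1 * y1)),
     (y1 * x2, (- (p ^ 2)) *\<^sub>k (x2 * y1) + x1 * y2),
     (y2 * x1, p *\<^sub>k (x1 * y2)),
     (y2 * x2, x1 * y1 + x2 * y2)}"

definition D_algebra :: "'k::field \<Rightarrow> ('k, (gen, 'k) ncpoly set) module" where
  "D_algebra p = presented_algebra (D_relations p)"

definition D_basis :: "'k::field \<Rightarrow> (gen, 'k) ncpoly set" where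
  "D_basis p =
    {x2 * x1 + x1 * x2,
     y2 * y1 - p *\<^sub>k (y1 * y2),
     x1 * y1 + p *\<^sub>k (y1 * x1),
     x2 * y1 + y1 * x2 - (1 / p) *\<^sub>k (y2 * x1),
     x1 * y2 - (1 / p) *\<^sub>k (y2 * x1),
     x2 * y2 - y2 * x2 - p *\<^sub>k (y1 * x1)}"

end

theory Submission
  imports Defs
begin

text \<open>
  Both values of \<open>p\<close> satisfy \<open>p\<^sup>2 = 1\<close>, hence \<open>1 / p = p\<close>; this is what makes the
  reductions below cancel.

  Every leading word of the six polynomials has length two, and the six leading words are
  distinct. Two leading words of length two can meet in only two ways: they coincide, so that
  both polynomials are the same and their composition is \<open>0\<close>, or they share one letter
  (\<open>quadratic_composition_cases\<close>). Among the leading words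
  \<open>x\<^sub>2x\<^sub>1, y\<^sub>2y\<^sub>1, x\<^sub>1y\<^sub>1, x\<^sub>2y\<^sub>1, x\<^sub>1y\<^sub>2, x\<^sub>2y\<^sub>2\<close> the second case occurs exactly at the four words
  \<open>x\<^sub>1y\<^sub>2y\<^sub>1, x\<^sub>2y\<^sub>2y\<^sub>1, x\<^sub>2x\<^sub>1y\<^sub>1, x\<^sub>2x\<^sub>1y\<^sub>2\<close>. Each of these compositions reduces to \<open>0\<close> when leading words
  are rewritten by the remaining terms, and the polynomials used along the way, multiplied by
  the surrounding letters, give the combinations in \<open>overlaps_trivial\<close>.

  The equality of ideals holds because the six defining relations of the algebra and the six
  polynomials are linear combinations of each other (\<open>generated_ideal_D_basis\<close>). The
  two algebras are then quotients by the same ideal.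
\<close>

section \<open>Scalars and words in the free algebra\<close>

lemma word_Nil [simp]: "word [] = 1"
  by (simp add: word_def flip: single_one zero_list_def)

lemma word_times_word: "word u * word v = word (u @ v)"
  by (simp add: word_def mult_single plus_list_def)

lemma scale_word: "c *\<^sub>k word w = Poly_Mapping.single w c"
  by (simp add: word_def scale_def mult_single plus_list_def)

text \<open>
  Constants sit on the empty word, which is neutral for concatenation on both sides. Centrality
  is what allows scalars to be moved past noncommuting letters.
\<close>

lemma constant_central:
  fixes f :: "('x, 'k::field) ncpoly"
  shows "f * Poly_Mapping.single [] c = Poly_Mapping.single [] c * f"
proof (induction f rule: update_induct)
  case const
  show ?case
    by simp
next
  case (update f w d)
  have "Poly_Mapping.update w d f = f + Poly_Mapping.single w d"
    using update.hyps
    by (intro poly_mapping_eqI) (auto simp: lookup_update lookup_add lookup_single in_keys_iff when_def)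
  with update.IH show ?case
    by (simp add: distrib_left distrib_right mult_single plus_list_def mult.commute)
qed

lemma mult_scale_left [simp]: "(c *\<^sub>k f) * g = c *\<^sub>k (f * g)"
  by (simp add: scale_def mult.assoc)

lemma mult_scale_right [simp]: "f * (c *\<^sub>k g) = c *\<^sub>k (f * g)"
  by (simp add: scale_def constant_central flip: mult.assoc)

lemma scale_scale [simp]: "c *\<^sub>k (d *\<^sub>k f) = (c * d) *\<^sub>k f"
  by (simp add: scale_def mult_single plus_list_def flip: mult.assoc)

lemma scale_zero [simp]: "0 *\<^sub>k f = 0"
  by (simp add: scale_def)

lemma scale_one [simp]: "1 *\<^sub>k f = f"
  by (simp add: scale_def flip: zero_list_def)

lemma scale_uminus [simp]: "(- c) *\<^sub>k f = - (c *\<^sub>k f)"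
  by (simp add: scale_def single_uminus)

lemma scale_distribs:
  "c *\<^sub>k (f + g) = c *\<^sub>k f + c *\<^sub>k g"
  "c *\<^sub>k (f - g) = c *\<^sub>k f - c *\<^sub>k g"
  "c *\<^sub>k (- f) = - (c *\<^sub>k f)"
  by (simp_all add: scale_def algebra_simps)

section \<open>Leading words and trivial compositions\<close>

lemma deglex_asym: "u \<prec> v \<Longrightarrow> \<not> v \<prec> u" for u v :: "'x::linorder list"
proof -
  have "asym (lenlex {(a, b :: 'x). a < b})"
    by (rule asym_lenlex) (auto intro: asymI)
  then show "u \<prec> v \<Longrightarrow> \<not> v \<prec> u"
    by (auto simp: deglex_def dest: asymD)
qed

lemma deglex_irrefl: "\<not> w \<prec> w"
  using deglex_asym by blast

text \<open>Turns the definite description of the leading word into a check on the other terms.\<close>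

lemma leading_word_plus_smaller:
  fixes t :: "('x::linorder, 'k::field) ncpoly"
  assumes smaller: "\<And>v. v \<in> Poly_Mapping.keys t \<Longrightarrow> v \<prec> w"
  shows "leading_word (word w + t) = w" and "monic (word w + t)"
proof -
  let ?f = "word w + t"
  have "Poly_Mapping.lookup t w = 0"
    using smaller deglex_irrefl by (metis in_keys_iff)
  then have coeff: "Poly_Mapping.lookup ?f w = 1"
    by (simp add: word_def lookup_add)
  then have w: "w \<in> Poly_Mapping.keys ?f"
    by (simp add: in_keys_iff)
  have "Poly_Mapping.keys ?f \<subseteq> insert w (Poly_Mapping.keys t)"
    using Poly_Mapping.keys_add[of "word w" t] by (simp add: word_def)
  then have max: "v \<prec> w" if "v \<in> Poly_Mapping.keys ?f" "v \<noteq> w" for v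
    using smaller that by auto
  show lead: "leading_word ?f = w"
    unfolding leading_word_def
  proof (rule the_equality)
    show "w \<in> Poly_Mapping.keys ?f \<and> (\<forall>v\<in>Poly_Mapping.keys ?f. v \<noteq> w \<longrightarrow> v \<prec> w)"
      using w max by simp
    fix u
    assume u: "u \<in> Poly_Mapping.keys ?f \<and> (\<forall>v\<in>Poly_Mapping.keys ?f. v \<noteq> u \<longrightarrow> v \<prec> u)"
    show "u = w"
    proof (rule ccontr)
      assume "u \<noteq> w"
      then have "w \<prec> u" and "u \<prec> w"
        using u w max by auto
      then show False
        using deglex_asym by blast
    qed
  qed
  show "monic ?f"
    unfolding monic_def lead using coeff by auto
qed

text \<open>
  Lets the summands that witness triviality be written down as an explicit list instead of
  as four families indexed by numbers.
\<close>

lemma trivial_modulo_sum_list: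
  assumes "\<And>c a s b. (c, a, s, b) \<in> set L \<Longrightarrow> s \<in> S \<and> a @ leading_word s @ b \<prec> w"
    and h: "h = (\<Sum>(c, a, s, b) \<leftarrow> L. c *\<^sub>k (word a * s * word b))"
  shows "trivial_modulo S w h"
  unfolding trivial_modulo_def
proof (intro exI conjI allI impI)
  let ?\<alpha> = "\<lambda>i. fst (L ! i)" and ?a = "\<lambda>i. fst (snd (L ! i))"
    and ?s = "\<lambda>i. fst (snd (snd (L ! i)))" and ?b = "\<lambda>i. snd (snd (snd (L ! i)))"
  show "h = (\<Sum>i<length L. ?\<alpha> i *\<^sub>k (word (?a i) * ?s i * word (?b i)))"
    by (simp add: h sum_list_sum_nth case_prod_beta atLeast0LessThan)
  fix i assume "i < length L"
  then have "(?\<alpha> i, ?a i, ?s i, ?b i) \<in> set L"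
    by simp
  then show "?s i \<in> S" "?a i @ leading_word (?s i) @ ?b i \<prec> w"
    using assms(1) by blast+
qed

lemma trivial_modulo_0: "trivial_modulo S w 0"
  by (rule trivial_modulo_sum_list[where L = "[]"]) auto

text \<open>
  The word \<open>w\<close> of an intersection is shorter than \<open>2 + 2\<close>, so the second leading word starts at
  position \<open>0\<close> or \<open>1\<close> of \<open>w\<close>; an inclusion between words of the same length is an equality.
\<close>

lemma quadratic_composition_cases:
  assumes "composition f g w h"
    and "leading_word f = [u, v]" and "leading_word g = [u', v']"
  obtains (same) "leading_word f = leading_word g" "h = f - g"
    | (overlap) "v = u'" "w = [u, v, v']" "h = f * word [v'] - word [u] * g"
  using assms(1)
proof cases
  case (intersection a b)
  have "length b < 2"
    using intersection(4) arg_cong[OF intersection(2), of length] arg_cong[OF intersection(3), of length]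
      assms(2,3) by simp
  then consider "b = []" | c where "b = [c]"
    by (cases b; cases "tl b") auto
  then show ?thesis
  proof cases
    case 1
    with intersection assms(2,3) show ?thesis
      by (intro same) auto
  next
    case 2
    with intersection assms(2,3) show ?thesis
      by (intro overlap) auto
  qed
next
  case (inclusion a b)
  with assms(2,3) have "a = [] \<and> b = []"
    by (cases a; cases "tl a") auto
  with inclusion assms(2,3) show ?thesis
    by (intro same) auto
qed

section \<open>The six polynomials\<close>

text \<open>Each polynomial is named after its leading word. Where \<open>D_basis\<close> has the
  coefficient \<open>1 / p\<close>, these have \<open>p\<close>, so that no division occurs in the reductions.\<close>

definition g_x2x1 :: "(gen, 'k::field) ncpoly" where "g_x2x1 = x2 * x1 + x1 * x2"
definition g_y2y1 :: "'k::field \<Rightarrow> (gen, 'k) ncpoly" where "g_y2y1 p = y2 * y1 - p *\<^sub>k (y1 * y2)"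
definition g_x1y1 :: "'k::field \<Rightarrow> (gen, 'k) ncpoly" where "g_x1y1 p = x1 * y1 + p *\<^sub>k (y1 * x1)"
definition g_x2y1 :: "'k::field \<Rightarrow> (gen, 'k) ncpoly" where
  "g_x2y1 p = x2 * y1 + y1 * x2 - p *\<^sub>k (y2 * x1)"
definition g_x1y2 :: "'k::field \<Rightarrow> (gen, 'k) ncpoly" where "g_x1y2 p = x1 * y2 - p *\<^sub>k (y2 * x1)"
definition g_x2y2 :: "'k::field \<Rightarrow> (gen, 'k) ncpoly" where
  "g_x2y2 p = x2 * y2 - y2 * x2 - p *\<^sub>k (y1 * x1)"

lemmas g_defs = g_x2x1_def g_y2y1_def g_x1y1_def g_x2y1_def g_x1y2_def g_x2y2_def

lemma D_basis_eq:
  assumes "p * p = 1"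
  shows "D_basis p = {g_x2x1, g_y2y1 p, g_x1y1 p, g_x2y1 p, g_x1y2 p, g_x2y2 p}"
proof -
  have "1 / p = p"
    using assms by (metis mult_zero_left nonzero_eq_divide_eq zero_neq_one)
  then show ?thesis
    by (simp add: D_basis_def g_defs)
qed

text \<open>
  The six polynomials have at most two terms besides the leading one; with a single such
  term, \<open>d = 0\<close> is taken.
\<close>

lemma leading_word_three_terms:
  assumes f: "f = word w + (c *\<^sub>k word u + d *\<^sub>k word v)" and less: "u \<prec> w" "v \<prec> w"
  shows "leading_word f = w" and "monic f"
proof -
  have "Poly_Mapping.keys (c *\<^sub>k word u + d *\<^sub>k word v) \<subseteq> {u, v}"
    using Poly_Mapping.keys_add[of "c *\<^sub>k word u" "d *\<^sub>k word v"]
    by (auto simp: scale_word split: if_splits)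
  with less have "x \<prec> w" if "x \<in> Poly_Mapping.keys (c *\<^sub>k word u + d *\<^sub>k word v)" for x
    using that by auto
  from leading_word_plus_smaller[OF this] show "leading_word f = w" and "monic f"
    unfolding f by blast+
qed

lemmas deglex_simps = deglex_def Cons_lenlex_iff less_gen_def

lemma leading_word_g:
  "leading_word g_x2x1 = [X2, X1]" "monic g_x2x1"
  "leading_word (g_y2y1 p) = [Y2, Y1]" "monic (g_y2y1 p)"
  "leading_word (g_x1y1 p) = [X1, Y1]" "monic (g_x1y1 p)"
  "leading_word (g_x2y1 p) = [X2, Y1]" "monic (g_x2y1 p)"
  "leading_word (g_x1y2 p) = [X1, Y2]" "monic (g_x1y2 p)"
  "leading_word (g_x2y2 p) = [X2, Y2]" "monic (g_x2y2 p)"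
proof -
  show "leading_word g_x2x1 = [X2, X1]" "monic g_x2x1"
    by (rule leading_word_three_terms[where w = "[X2, X1]"
          and u = "[X1, X2]" and c = 1 and v = "[X1, X2]" and d = 0],
        simp_all add: g_defs word_times_word deglex_simps)+
  show "leading_word (g_y2y1 p) = [Y2, Y1]" "monic (g_y2y1 p)"
    by (rule leading_word_three_terms[where w = "[Y2, Y1]"
          and u = "[Y1, Y2]" and c = "- p" and v = "[Y1, Y2]" and d = 0],
        simp_all add: g_defs word_times_word deglex_simps)+
  show "leading_word (g_x1y1 p) = [X1, Y1]" "monic (g_x1y1 p)"
    by (rule leading_word_three_terms[where w = "[X1, Y1]"
          and u = "[Y1, X1]" and c = "p" and v = "[Y1, X1]" and d = 0],
        simp_all add: g_defs word_times_word deglex_simps)+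
  show "leading_word (g_x2y1 p) = [X2, Y1]" "monic (g_x2y1 p)"
    by (rule leading_word_three_terms[where w = "[X2, Y1]"
          and u = "[Y1, X2]" and c = 1 and v = "[Y2, X1]" and d = "- p"],
        simp_all add: g_defs word_times_word deglex_simps)+
  show "leading_word (g_x1y2 p) = [X1, Y2]" "monic (g_x1y2 p)"
    by (rule leading_word_three_terms[where w = "[X1, Y2]"
          and u = "[Y2, X1]" and c = "- p" and v = "[Y2, X1]" and d = 0],
        simp_all add: g_defs word_times_word deglex_simps)+
  show "leading_word (g_x2y2 p) = [X2, Y2]" "monic (g_x2y2 p)"
    by (rule leading_word_three_terms[where w = "[X2, Y2]"
          and u = "[Y2, X2]" and c = "- 1" and v = "[Y1, X1]" and d = "- p"],
        simp_all add: g_defs word_times_word deglex_simps)+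
qed

section \<open>The four overlaps\<close>

text \<open>
  The entries \<open>(c, a, s, b)\<close> record the steps of a reduction: subtracting
  \<open>c *\<^sub>k (word a * s * word b)\<close> removes the term with coefficient \<open>c\<close> at the word
  \<open>a @ leading_word s @ b\<close> in favour of smaller words. For instance
  the first composition is \<open>p x\<^sub>1y\<^sub>1y\<^sub>2 - p y\<^sub>2x\<^sub>1y\<^sub>1\<close>. Its first term rewrites to
  \<open>- y\<^sub>1x\<^sub>1y\<^sub>2\<close> and then to \<open>- p y\<^sub>1y\<^sub>2x\<^sub>1\<close>, its second one to \<open>y\<^sub>2y\<^sub>1x\<^sub>1\<close> and then to
  \<open>p y\<^sub>1y\<^sub>2x\<^sub>1\<close>, so that they cancel. Rewriting always lowers the word, which gives the
  bound by \<open>w\<close>.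
\<close>

lemma overlaps_trivial:
  assumes "p * p = 1"
  shows "trivial_modulo (D_basis p) [X1, Y2, Y1] (g_x1y2 p * y1 - x1 * g_y2y1 p)"
    and "trivial_modulo (D_basis p) [X2, Y2, Y1] (g_x2y2 p * y1 - x2 * g_y2y1 p)"
    and "trivial_modulo (D_basis p) [X2, X1, Y1] (g_x2x1 * y1 - x2 * g_x1y1 p)"
    and "trivial_modulo (D_basis p) [X2, X1, Y2] (g_x2x1 * y2 - x2 * g_x1y2 p)"
proof -
  show "trivial_modulo (D_basis p) [X1, Y2, Y1] (g_x1y2 p * y1 - x1 * g_y2y1 p)"
    by (rule trivial_modulo_sum_list[where L = "[(- p, [Y2], g_x1y1 p, []), (1, [], g_y2y1 p, [X1]),
          (p, [], g_x1y1 p, [Y2]), (- 1, [Y1], g_x1y2 p, [])]"])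
      (auto simp: D_basis_eq assms leading_word_g deglex_simps,
        simp add: g_defs algebra_simps scale_distribs assms)
  show "trivial_modulo (D_basis p) [X2, Y2, Y1] (g_x2y2 p * y1 - x2 * g_y2y1 p)"
    by (rule trivial_modulo_sum_list[where L = "[(- 1, [Y2], g_x2y1 p, []), (1, [], g_y2y1 p, [X2]),
          (- p, [Y1], g_x1y1 p, []), (p, [], g_x2y1 p, [Y2]), (- p, [Y1], g_x2y2 p, []),
          (1, [Y2], g_x1y2 p, [])]"])
      (auto simp: D_basis_eq assms leading_word_g deglex_simps,
        simp add: g_defs algebra_simps scale_distribs assms)
  show "trivial_modulo (D_basis p) [X2, X1, Y1] (g_x2x1 * y1 - x2 * g_x1y1 p)"
    by (rule trivial_modulo_sum_list[where L = "[(1, [X1], g_x2y1 p, []), (- 1, [], g_x1y1 p, [X2]),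
          (p, [], g_x1y2 p, [X1]), (- p, [], g_x2y1 p, [X1]), (p, [Y1], g_x2x1, [])]"])
      (auto simp: D_basis_eq assms leading_word_g deglex_simps,
        simp add: g_defs algebra_simps scale_distribs assms)
  show "trivial_modulo (D_basis p) [X2, X1, Y2] (g_x2x1 * y2 - x2 * g_x1y2 p)"
    by (rule trivial_modulo_sum_list[where L = "[(1, [X1], g_x2y2 p, []), (1, [], g_x1y2 p, [X2]),
          (p, [], g_x1y1 p, [X1]), (p, [], g_x2y2 p, [X1]), (p, [Y2], g_x2x1, [])]"])
      (auto simp: D_basis_eq assms leading_word_g deglex_simps,
        simp add: g_defs algebra_simps scale_distribs assms)
qed

lemma D_basis_groebner_shirshov:
  assumes "p * p = 1"
  shows "groebner_shirshov_basis (D_basis p)"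
  unfolding groebner_shirshov_basis_def
proof (intro conjI ballI allI impI)
  show "D_basis p \<noteq> {}"
    by (simp add: D_basis_def)
  show "monic f" if "f \<in> D_basis p" for f
    using that by (auto simp: D_basis_eq assms leading_word_g)
  fix f g w h
  assume f: "f \<in> D_basis p" and g: "g \<in> D_basis p" and comp: "composition f g w h"
  obtain u v u' v' where lead: "leading_word f = [u, v]" "leading_word g = [u', v']"
    using f g by (auto simp: D_basis_eq assms leading_word_g)
  show "trivial_modulo (D_basis p) w h"
    using comp lead
  proof (cases rule: quadratic_composition_cases)
    case same
    with f g have "f = g"
      by (auto simp: D_basis_eq assms leading_word_g)
    with same show ?thesis
      by (simp add: trivial_modulo_0)
  next
    case overlap
    with f g lead show ?thesis
      by (auto simp: D_basis_eq[OF assms] leading_word_g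
          overlaps_trivial[OF assms, unfolded D_basis_eq[OF assms]])
  qed
qed

section \<open>The ideal of relations\<close>

lemma ideal_free_algebra_closed_under:
  assumes "ideal I free_algebra"
  shows "f \<in> I \<Longrightarrow> g \<in> I \<Longrightarrow> f + g \<in> I"
    and "f \<in> I \<Longrightarrow> c *\<^sub>k f \<in> I"
    and "f \<in> I \<Longrightarrow> - f \<in> I"
    and "f \<in> I \<Longrightarrow> g \<in> I \<Longrightarrow> f - g \<in> I"
proof -
  interpret ideal I free_algebra by fact
  show add: "f + g \<in> I" if "f \<in> I" "g \<in> I" for f g
    using additive_subgroup.a_closed[OF additive_subgroup_axioms that] by (simp add: free_algebra_def)
  show sc: "c *\<^sub>k f \<in> I" if "f \<in> I" for c f
    using I_l_closed[OF that] by (simp add: free_algebra_def scale_def)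
  show neg: "- f \<in> I" if "f \<in> I" for f
    using sc[OF that, of "- 1"] by simp
  show "f - g \<in> I" if "f \<in> I" "g \<in> I" for f g
    using add[OF that(1) neg[OF that(2)]] by simp
qed

text \<open>
  A generated ideal is the intersection of all ideals that contain its generators, so it
  suffices that every ideal contains one set if and only if it contains the other.
\<close>

lemma generated_ideal_D_basis:
  assumes "p * p = 1"
  shows "generated_ideal (D_basis p) = relation_ideal (D_relations p)"
proof -
  let ?R = "{l - r |l r. (l, r) \<in> D_relations p}"
  have R: "?R = {g_x2x1, g_y2y1 p, p *\<^sub>k g_x1y1 p, g_x2y1 p - g_x1y2 p,
      - (p *\<^sub>k g_x1y2 p), - (g_x2y2 p + g_x1y1 p)}"
    by (simp add: D_relations_def set_eq_iff ex_disj_distrib conj_disj_distribL)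
      (simp add: g_defs power2_eq_square assms scale_distribs algebra_simps)
  have "D_basis p \<subseteq> I \<longleftrightarrow> ?R \<subseteq> I" if I: "ideal I free_algebra" for I
  proof
    note closed = ideal_free_algebra_closed_under[OF I]
    show "?R \<subseteq> I" if "D_basis p \<subseteq> I"
      using that unfolding R D_basis_eq[OF assms] by (simp add: closed)
    assume "?R \<subseteq> I"
    then have rels: "g_x2x1 \<in> I" "g_y2y1 p \<in> I" "p *\<^sub>k g_x1y1 p \<in> I" "g_x2y1 p - g_x1y2 p \<in> I"
      "- (p *\<^sub>k g_x1y2 p) \<in> I" "- (g_x2y2 p + g_x1y1 p) \<in> I"
      unfolding R by simp_all
    have x1y1: "g_x1y1 p \<in> I"
      using closed(2)[OF rels(3), of p] by (simp add: assms)
    have x1y2: "g_x1y2 p \<in> I"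
      using closed(2)[OF rels(5), of "- p"] by (simp add: scale_distribs assms)
    have x2y1: "g_x2y1 p \<in> I"
      using closed(1)[OF rels(4) x1y2] by simp
    have x2y2: "g_x2y2 p \<in> I"
      using closed(4)[OF closed(3)[OF rels(6)] x1y1] by simp
    show "D_basis p \<subseteq> I"
      unfolding D_basis_eq[OF assms] using rels x1y1 x1y2 x2y1 x2y2 by simp
  qed
  then show ?thesis
    unfolding relation_ideal_def genideal_def by (intro arg_cong[where f = Inter]) blast
qed

theorem mainTheorem3:
  fixes p :: "'k::field"
  assumes "p \<in> {-1, 1}"
  shows "groebner_shirshov_basis (D_basis p) \<and>
         generated_ideal (D_basis p) = relation_ideal (D_relations p) \<and>
         D_algebra p = quotient_algebra free_algebra (generated_ideal (D_basis p))"
proof -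
  have "p * p = 1"
    using assms by auto
  then show ?thesis
    by (simp add: D_basis_groebner_shirshov generated_ideal_D_basis D_algebra_def
        presented_algebra_def)
qed

end
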